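(* Let $[A]$ and $[B]$ be distinct points of $\mathcal{S}$. Then there are continuum many geodesics in $(\mathcal{S},\delta)$ from $[A]$ to $[B]$.
   Context: For $A\subseteq\omega$ and $n\ge 1$, $\rho_n(A)=|A\cap[0,n)|/n$, and the upper density is $\overline{\rho}(A)=\limsup_n\rho_n(A)$. $A\bigtriangleup B$ is the symmetric difference. Sets $A,B\subseteq\omega$ are coarsely similar if $\lim_n\rho_n(A\bigtriangleup B)=0$; $[A]$ denotes the coarse similarity class of $A$ and $\mathcal{S}$ the set of all such classes. The metric $\delta$ on $\mathcal{S}$ is $\delta([A],[B])=\overline{\rho}(A\bigtriangleup B)$. A geodesic from $x$ to $y$ in a metric space $(M,d)$ is a map $\gamma:[0,1]\to M$ with $\gamma(0)=x$, $\gamma(1)=y$ and $d(\gamma(s),\gamma(t))=|t-s|\,d(x,y)$ for all $s,t\in[0,1]$. *)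

theory Defs
  imports "HOL-Analysis.Analysis" "HOL-Library.Equipollence"
begin

text \<open>The value at \<open>n = 0\<close> is \<open>0 / 0 = 0\<close>; it does not affect any limit.\<close>

definition density_below :: "nat \<Rightarrow> nat set \<Rightarrow> real" (\<open>\<rho>\<close>)
  where "\<rho> n A = real (card (A \<inter> {0..<n})) / real n"

text \<open>The limit superior is taken in the extended reals, where it always exists; it is finite by
  the lemma \<open>ereal_upper_density\<close> below.\<close>

definition upper_density :: "nat set \<Rightarrow> real"
  where "upper_density A = real_of_ereal (limsup (\<lambda>n. ereal (\<rho> n A)))"

definition coarsely_similar :: "nat set \<Rightarrow> nat set \<Rightarrow> bool"
  where "coarsely_similar A B \<longleftrightarrow> (\<lambda>n. \<rho> n (sym_diff A B)) \<longlonglongrightarrow> 0"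

lemma density_below_nonneg: "0 \<le> \<rho> n A"
  by (simp add: density_below_def)

lemma density_below_le_1: "\<rho> n A \<le> 1"
proof -
  have "card (A \<inter> {0..<n}) \<le> card {0..<n}"
    by (intro card_mono) auto
  then show ?thesis
    by (cases "n = 0") (simp_all add: density_below_def)
qed

lemma density_below_subadd:
  assumes "A \<subseteq> B \<union> C"
  shows "\<rho> n A \<le> \<rho> n B + \<rho> n C"
proof -
  have "card (A \<inter> {0..<n}) \<le> card ((B \<inter> {0..<n}) \<union> (C \<inter> {0..<n}))"
    using assms by (intro card_mono) auto
  also have "\<dots> \<le> card (B \<inter> {0..<n}) + card (C \<inter> {0..<n})"
    by (rule card_Un_le)
  finally have "real (card (A \<inter> {0..<n})) \<le> real (card (B \<inter> {0..<n})) + real (card (C \<inter> {0..<n}))"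
    by linarith
  then show ?thesis
    by (simp add: density_below_def divide_right_mono flip: add_divide_distrib)
qed

lemma ereal_upper_density: "ereal (upper_density A) = limsup (\<lambda>n. ereal (\<rho> n A))"
proof -
  have "limsup (\<lambda>n. ereal (\<rho> n A)) \<le> ereal 1"
    by (intro Limsup_bounded always_eventually) (simp add: density_below_le_1)
  moreover have "ereal 0 \<le> limsup (\<lambda>n. ereal (\<rho> n A))"
    by (intro le_Limsup always_eventually) (simp_all add: density_below_nonneg)
  ultimately show ?thesis
    unfolding upper_density_def by (cases "limsup (\<lambda>n. ereal (\<rho> n A))") auto
qed

lemma upper_density_subadd:
  assumes "A \<subseteq> B \<union> C"
  shows "upper_density A \<le> upper_density B + upper_density C"
proof -
  have "ereal (upper_density A) \<le> limsup (\<lambda>n. ereal (\<rho> n B) + ereal (\<rho> n C))"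
    unfolding ereal_upper_density
    by (intro Limsup_mono always_eventually) (simp add: density_below_subadd[OF assms])
  also have "\<dots> \<le> ereal (upper_density B) + ereal (upper_density C)"
    unfolding ereal_upper_density by (rule ereal_limsup_add_mono)
  finally show ?thesis
    by simp
qed

lemma upper_density_eq_0_iff: "upper_density A = 0 \<longleftrightarrow> (\<lambda>n. \<rho> n A) \<longlonglongrightarrow> 0"
proof
  assume "upper_density A = 0"
  then have sup: "limsup (\<lambda>n. ereal (\<rho> n A)) = ereal 0"
    by (metis ereal_upper_density)
  have "ereal 0 \<le> liminf (\<lambda>n. ereal (\<rho> n A))"
    by (intro Liminf_bounded always_eventually) (simp add: density_below_nonneg)
  moreover have "liminf (\<lambda>n. ereal (\<rho> n A)) \<le> limsup (\<lambda>n. ereal (\<rho> n A))"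
    by (intro Liminf_le_Limsup) simp
  ultimately have "(\<lambda>n. ereal (\<rho> n A)) \<longlonglongrightarrow> ereal 0"
    using sup by (intro iffD2[OF tendsto_iff_Liminf_eq_Limsup]) auto
  then show "(\<lambda>n. \<rho> n A) \<longlonglongrightarrow> 0"
    by simp
next
  assume "(\<lambda>n. \<rho> n A) \<longlonglongrightarrow> 0"
  then have "(\<lambda>n. ereal (\<rho> n A)) \<longlonglongrightarrow> ereal 0"
    by simp
  then have "limsup (\<lambda>n. ereal (\<rho> n A)) = ereal 0"
    by (intro lim_imp_Limsup) auto
  then show "upper_density A = 0"
    by (simp add: upper_density_def)
qed

lemma coarsely_similar_iff: "coarsely_similar A B \<longleftrightarrow> upper_density (sym_diff A B) = 0"
  by (simp add: coarsely_similar_def upper_density_eq_0_iff)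

lemma upper_density_nonneg: "0 \<le> upper_density A"
  using upper_density_subadd[of A A A] by simp

lemma upper_density_sym_diff_triangle:
  "upper_density (sym_diff A C) \<le> upper_density (sym_diff A B) + upper_density (sym_diff B C)"
  by (rule upper_density_subadd) auto

lemma equivp_coarsely_similar: "equivp coarsely_similar"
proof (rule equivpI)
  show "reflp coarsely_similar"
    by (simp add: reflp_def coarsely_similar_def density_below_def)
  show "symp coarsely_similar"
    by (simp add: symp_def coarsely_similar_def Un_commute)
  show "transp coarsely_similar"
    unfolding transp_def coarsely_similar_iff
    by (metis add.right_neutral order_antisym upper_density_nonneg upper_density_sym_diff_triangle)
qed

text \<open>The type \<open>coarse_class\<close> is the space \<open>\<S>\<close> of coarse similarity classes; \<open>coarse_class A\<close> is
  the class \<open>[A]\<close>. Its \<open>dist\<close> is the metric \<open>\<delta>\<close>.\<close>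

quotient_type coarse_class = "nat set" / coarsely_similar
  morphisms rep_coarse_class coarse_class
  by (rule equivp_coarsely_similar)

instantiation coarse_class :: metric_space
begin

lift_definition dist_coarse_class :: "coarse_class \<Rightarrow> coarse_class \<Rightarrow> real"
  is "\<lambda>A B. upper_density (sym_diff A B)"
proof -
  fix A A' B B' :: "nat set"
  assume A: "coarsely_similar A A'" and B: "coarsely_similar B B'"
  have A0: "upper_density (sym_diff A A') = 0" "upper_density (sym_diff A' A) = 0"
    using A by (simp_all add: coarsely_similar_iff Un_commute)
  have B0: "upper_density (sym_diff B B') = 0" "upper_density (sym_diff B' B) = 0"
    using B by (simp_all add: coarsely_similar_iff Un_commute)
  show "upper_density (sym_diff A B) = upper_density (sym_diff A' B')"
    using upper_density_sym_diff_triangle[where A = A and B = A' and C = B]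
      upper_density_sym_diff_triangle[where A = A' and B = B' and C = B]
      upper_density_sym_diff_triangle[where A = A' and B = A and C = B']
      upper_density_sym_diff_triangle[where A = A and B = B and C = B'] A0 B0
    by linarith
qed

definition uniformity_coarse_class :: "(coarse_class \<times> coarse_class) filter"
  where "uniformity_coarse_class = (INF e\<in>{0<..}. principal {(x, y). dist x y < e})"

definition open_coarse_class :: "coarse_class set \<Rightarrow> bool"
  where "open_coarse_class U \<longleftrightarrow> (\<forall>x\<in>U. \<forall>\<^sub>F (x', y) in uniformity. x' = x \<longrightarrow> y \<in> U)"

instance
proof
  fix x y z :: coarse_class
  show "dist x y = 0 \<longleftrightarrow> x = y"
    by transfer (simp add: coarsely_similar_iff)
  show "dist x y \<le> dist x z + dist y z"
  proof transfer
    fix A B C :: "nat set"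
    show "upper_density (sym_diff A B) \<le> upper_density (sym_diff A C) + upper_density (sym_diff B C)"
      by (rule upper_density_subadd) auto
  qed
qed (fact uniformity_coarse_class_def open_coarse_class_def)+

end

text \<open>Maps with domain \<open>[0, 1]\<close> are represented by functions on the reals with the fixed value
  \<open>undefined\<close> off \<open>[0, 1]\<close>, so that two geodesics are equal iff they agree on \<open>[0, 1]\<close>. This is
  needed for counting them.\<close>

definition geodesics :: "'a::metric_space \<Rightarrow> 'a \<Rightarrow> (real \<Rightarrow> 'a) set"
  where "geodesics x y =
    {\<gamma> \<in> extensional {0..1}. \<gamma> 0 = x \<and> \<gamma> 1 = y \<and>
      (\<forall>s\<in>{0..1}. \<forall>t\<in>{0..1}. dist (\<gamma> s) (\<gamma> t) = \<bar>t - s\<bar> * dist x y)}"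

end

theory Submission
  imports Defs "HOL-Real_Asymp.Real_Asymp"
begin

text \<open>
  Put \<open>D = A \<triangle> B\<close> and let \<open>u\<close> be a sequence that is equidistributed in \<open>[0, 1)\<close>. If \<open>D\<^sub>t\<close> consists of
  those elements of \<open>D\<close> whose index \<open>k\<close> in the increasing enumeration of \<open>D\<close> satisfies \<open>u k < t\<close>, then
  \<open>D\<^sub>t \<setminus> D\<^sub>s\<close> has relative density \<open>t - s\<close> in \<open>D\<close>, so \<open>t \<mapsto> [A \<triangle> D\<^sub>t]\<close> is a geodesic. The van der Corput
  sequence is equidistributed, and it remains so after composition with the map that sends \<open>[0, r)\<close>
  and \<open>[r, 1)\<close> each linearly onto \<open>[0, 1)\<close>. Different \<open>r\<close> give geodesics that differ at \<open>1 / 2\<close>. For the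
  upper bound, a geodesic is continuous and so determined by its values at rational points.
\<close>

section \<open>Counting and density of initial segments\<close>

lemma card_Int_atLeastLessThan_Suc:
  "card (S \<inter> {0..<Suc n}) = card (S \<inter> {0..<n}) + of_bool (n \<in> S)"
  by (cases "n \<in> S") (simp_all add: atLeastLessThanSuc Int_insert_right)

lemma density_below_Un_disjoint:
  assumes "U \<inter> V = {}"
  shows "\<rho> n (U \<union> V) = \<rho> n U + \<rho> n V"
proof -
  have "card ((U \<inter> {0..<n}) \<union> (V \<inter> {0..<n})) = card (U \<inter> {0..<n}) + card (V \<inter> {0..<n})"
    using assms by (intro card_Un_disjoint) auto
  then show ?thesis
    by (simp add: density_below_def Int_Un_distrib2 add_divide_distrib)
qed

lemma density_below_Diff:
  assumes "U \<subseteq> V"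
  shows "\<rho> n (V - U) = \<rho> n V - \<rho> n U"
proof -
  have "U \<union> (V - U) = V"
    using assms by blast
  then show ?thesis
    using density_below_Un_disjoint[of U "V - U" n] by simp
qed

lemma infinite_if_upper_density_nonzero:
  assumes "upper_density D \<noteq> 0"
  shows "infinite D"
proof
  assume fin: "finite D"
  have "(\<lambda>n. \<rho> n D) \<longlonglongrightarrow> 0"
  proof (rule tendsto_sandwich[of "\<lambda>_. 0"])
    have "\<rho> n D \<le> real (card D) / real n" for n
      unfolding density_below_def using fin by (intro divide_right_mono) (auto intro: card_mono)
    then show "\<forall>\<^sub>F n in sequentially. \<rho> n D \<le> real (card D) / real n"
      by simp
    show "(\<lambda>n. real (card D) / real n) \<longlonglongrightarrow> 0"
      by real_asymp
  qed (auto simp: density_below_nonneg)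
  then show False
    using assms upper_density_eq_0_iff by blast
qed

lemma filterlim_card_Int_atLeastLessThan:
  fixes D :: "nat set"
  assumes "infinite D"
  shows "filterlim (\<lambda>n. card (D \<inter> {0..<n})) sequentially sequentially"
  unfolding filterlim_at_top
proof
  fix Z :: nat
  obtain F where F: "F \<subseteq> D" "finite F" "card F = Z"
    using assms infinite_arbitrarily_large by metis
  obtain m where m: "F \<subseteq> {0..<m}"
    using F(2) finite_nat_iff_bounded atLeast0LessThan by metis
  have "Z \<le> card (D \<inter> {0..<n})" if "n \<ge> m" for n
    unfolding F(3)[symmetric] using F(1) m that by (intro card_mono) force+
  then show "\<forall>\<^sub>F n in sequentially. Z \<le> card (D \<inter> {0..<n})"
    using eventually_at_top_linorder by blast
qed

section \<open>Selecting elements of a set by their index\<close>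

text \<open>For \<open>x\<close> in \<open>D\<close> the cardinality is the index of
  \<open>x\<close> in the increasing enumeration of \<open>D\<close>, counted from 0.\<close>

definition thin :: "nat set \<Rightarrow> nat set \<Rightarrow> nat set"
  where "thin D U = {x \<in> D. card (D \<inter> {0..<x}) \<in> U}"

lemma card_thin: "card (thin D U \<inter> {0..<n}) = card (U \<inter> {0..<card (D \<inter> {0..<n})})"
proof (induction n)
  case 0
  then show ?case by simp
next
  case (Suc n)
  then show ?case
    by (cases "n \<in> D") (simp_all add: card_Int_atLeastLessThan_Suc thin_def)
qed

text \<open>The number of elements of \<open>D\<close> below \<open>n\<close> cancels between the
  two factors. If it is 0, both sides are 0 by the convention on division by 0.\<close>

lemma density_below_thin: "\<rho> n (thin D U) = \<rho> (card (D \<inter> {0..<n})) U * \<rho> n D"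
  by (simp add: density_below_def card_thin)

text \<open>The first factor of \<open>density_below_thin\<close> converges because the index tends
  to infinity with \<open>n\<close>, so it can be pulled out of the limit superior.\<close>

lemma upper_density_thin:
  assumes "infinite D" and U: "(\<lambda>n. \<rho> n U) \<longlonglongrightarrow> a"
  shows "upper_density (thin D U) = a * upper_density D"
proof -
  have lim: "(\<lambda>n. \<rho> (card (D \<inter> {0..<n})) U) \<longlonglongrightarrow> a"
    using filterlim_compose[OF U filterlim_card_Int_atLeastLessThan[OF assms(1)]] .
  have "0 \<le> a"
    using U by (rule LIMSEQ_le_const) (simp add: density_below_nonneg)
  then consider "a = 0" | "a > 0"
    by linarith
  then show ?thesis
  proof cases
    \<comment> \<open>The product rule for \<open>limsup\<close> used below asks for a positive
      limit, so 0 is treated by squeezing.\<close>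
    case 1
    have "(\<lambda>n. \<rho> n (thin D U)) \<longlonglongrightarrow> 0"
    proof (rule tendsto_sandwich[of "\<lambda>_. 0"])
      show "\<forall>\<^sub>F n in sequentially. \<rho> n (thin D U) \<le> \<rho> (card (D \<inter> {0..<n})) U"
        by (simp add: density_below_thin density_below_nonneg density_below_le_1 mult_left_le)
      show "(\<lambda>n. \<rho> (card (D \<inter> {0..<n})) U) \<longlonglongrightarrow> 0"
        using lim 1 by simp
    qed (auto simp: density_below_nonneg)
    then show ?thesis
      using 1 upper_density_eq_0_iff by simp
  next
    case 2
    have "limsup (\<lambda>n. ereal (\<rho> (card (D \<inter> {0..<n})) U) * ereal (\<rho> n D))
        = ereal a * limsup (\<lambda>n. ereal (\<rho> n D))"
      using lim 2 by (intro ereal_limsup_lim_mult) auto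
    then have "ereal (upper_density (thin D U)) = ereal a * ereal (upper_density D)"
      unfolding ereal_upper_density by (simp add: density_below_thin)
    then show ?thesis
      by simp
  qed
qed

section \<open>Geodesics from equidistributed sequences\<close>

text \<open>Initial intervals suffice, since other half-open intervals are their differences. The
  range condition makes the path built from \<open>u\<close> start and end exactly at the two given
  classes.\<close>

definition equidistributed :: "(nat \<Rightarrow> real) \<Rightarrow> bool"
  where "equidistributed u \<longleftrightarrow>
    range u \<subseteq> {0..<1} \<and> (\<forall>t\<in>{0..1}. (\<lambda>n. \<rho> n {k. u k < t}) \<longlonglongrightarrow> t)"

lemma equidistributed_bounds: "equidistributed u \<Longrightarrow> 0 \<le> u k \<and> u k < 1"
  by (auto simp: equidistributed_def image_subset_iff)

lemma upper_density_thin_equidistributed: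
  assumes "equidistributed u" "infinite D" "0 \<le> s" "s \<le> t" "t \<le> 1"
  shows "upper_density (thin D {k. s \<le> u k \<and> u k < t}) = (t - s) * upper_density D"
proof (rule upper_density_thin[OF assms(2)])
  have "{k. s \<le> u k \<and> u k < t} = {k. u k < t} - {k. u k < s}"
    by auto
  moreover have "\<rho> n ({k. u k < t} - {k. u k < s}) = \<rho> n {k. u k < t} - \<rho> n {k. u k < s}" for n
    using assms by (intro density_below_Diff) auto
  moreover have "(\<lambda>n. \<rho> n {k. u k < t} - \<rho> n {k. u k < s}) \<longlonglongrightarrow> t - s"
    using assms by (intro tendsto_diff) (auto simp: equidistributed_def)
  ultimately show "(\<lambda>n. \<rho> n {k. s \<le> u k \<and> u k < t}) \<longlonglongrightarrow> t - s"
    by simp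
qed

definition slice_path :: "nat set \<Rightarrow> nat set \<Rightarrow> (nat \<Rightarrow> real) \<Rightarrow> real \<Rightarrow> coarse_class"
  where "slice_path A B u =
    (\<lambda>t\<in>{0..1}. coarse_class (sym_diff A (thin (sym_diff A B) {k. u k < t})))"

lemma dist_coarse_class: "dist (coarse_class A) (coarse_class B) = upper_density (sym_diff A B)"
  by transfer simp

lemma slice_path_geodesic:
  assumes u: "equidistributed u" and AB: "upper_density (sym_diff A B) \<noteq> 0"
  shows "slice_path A B u \<in> geodesics (coarse_class A) (coarse_class B)"
proof -
  let ?D = "sym_diff A B"
  have inf: "infinite ?D"
    by (rule infinite_if_upper_density_nonzero[OF AB])
  have range: "0 \<le> u k" "u k < 1" for k
    using equidistributed_bounds[OF u] by auto
  have mono: "dist (slice_path A B u s) (slice_path A B u t)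
      = (t - s) * dist (coarse_class A) (coarse_class B)"
    if "0 \<le> s" "s \<le> t" "t \<le> 1" for s t
  proof -
    \<comment> \<open>\<open>A\<close> cancels, and the slices are nested because
      \<open>s \<le> t\<close>.\<close>
    have "sym_diff (sym_diff A (thin ?D {k. u k < s})) (sym_diff A (thin ?D {k. u k < t}))
        = thin ?D {k. s \<le> u k \<and> u k < t}"
      using that by (auto simp: thin_def)
    then show ?thesis
      using that
      by (simp add: slice_path_def dist_coarse_class
          upper_density_thin_equidistributed[OF u inf] del: Un_iff Diff_iff)
  qed
  have "dist (slice_path A B u s) (slice_path A B u t)
      = \<bar>t - s\<bar> * dist (coarse_class A) (coarse_class B)"
    if "s \<in> {0..1}" "t \<in> {0..1}" for s t
    using mono[of s t] mono[of t s] that by (cases "s \<le> t") (auto simp: dist_commute)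
  moreover have "thin ?D {k. u k < 0} = {}" "thin ?D {k. u k < 1} = ?D"
    using range by (auto simp: thin_def not_less)
  moreover have "sym_diff A ?D = B"
    by auto
  ultimately show ?thesis
    by (simp add: geodesics_def slice_path_def)
qed

section \<open>The van der Corput sequence and its discrepancy\<close>

text \<open>The binary digits of \<open>n\<close> are mirrored at the binary point: the last digit
  becomes the first one after the point.\<close>

fun van_der_corput :: "nat \<Rightarrow> real"
  where "van_der_corput n =
    (if n = 0 then 0 else (van_der_corput (n div 2) + of_bool (odd n)) / 2)"

declare van_der_corput.simps [simp del]

lemma van_der_corput_double:
  "van_der_corput (2 * n) = van_der_corput n / 2"
  "van_der_corput (Suc (2 * n)) = (van_der_corput n + 1) / 2"
  by (cases "n = 0") (simp_all add: van_der_corput.simps[of 0] van_der_corput.simps[of "2 * n"]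
      van_der_corput.simps[of "Suc (2 * n)"])

lemma van_der_corput_bounds: "0 \<le> van_der_corput n \<and> van_der_corput n < 1"
proof (induction n rule: van_der_corput.induct)
  case (1 n)
  then show ?case
    by (subst (1 2) van_der_corput.simps) auto
qed

definition count_below :: "nat \<Rightarrow> real \<Rightarrow> nat"
  where "count_below n t = card ({k. van_der_corput k < t} \<inter> {0..<n})"

lemma count_below_Suc:
  "count_below (Suc n) t = count_below n t + of_bool (van_der_corput n < t)"
  by (simp add: count_below_def card_Int_atLeastLessThan_Suc)

text \<open>Even indices give a copy of the sequence scaled into the left half of the unit interval,
  odd indices a copy in the right half.\<close>

lemma count_below_double:
  "count_below (2 * n) t = count_below n (2 * t) + count_below n (2 * t - 1)"
proof (induction n)
  case 0
  then show ?case by (simp add: count_below_def)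
next
  case (Suc n)
  have "van_der_corput n / 2 < t \<longleftrightarrow> van_der_corput n < 2 * t"
    "(van_der_corput n + 1) / 2 < t \<longleftrightarrow> van_der_corput n < 2 * t - 1"
    by (auto simp: field_simps)
  then show ?case
    using Suc by (simp add: count_below_Suc van_der_corput_double)
qed

lemma count_below_nonpos:
  assumes "t \<le> 0"
  shows "count_below n t = 0"
proof -
  have "{k. van_der_corput k < t} = {}"
    using assms van_der_corput_bounds by (auto simp: not_less intro: order_trans)
  then show ?thesis
    by (simp add: count_below_def)
qed

lemma count_below_ge_1:
  assumes "1 \<le> t"
  shows "count_below n t = n"
proof -
  have "{k. van_der_corput k < t} = UNIV"
    using assms van_der_corput_bounds less_le_trans by blast
  then show ?thesis
    by (simp add: count_below_def)
qed

text \<open>Halving \<open>n\<close> leaves the error unchanged up to rescaling \<open>t\<close>,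
  because one of the two half-size counts is always exact. Only an odd \<open>n\<close> adds to the
  error, by at most 1, and there are logarithmically many halvings.\<close>

lemma van_der_corput_discrepancy:
  assumes "0 \<le> t" "t \<le> 1"
  shows "\<bar>real (count_below n t) - real n * t\<bar> \<le> log 2 (real n + 1)"
  using assms
proof (induction n arbitrary: t rule: less_induct)
  case (less n)
  show ?case
  proof (cases "n = 0")
    case True
    then show ?thesis by (simp add: count_below_def)
  next
    case False
    define k where "k = n div 2"
    have "k < n"
      using False by (simp add: k_def)
    have double: "\<bar>real (count_below (2 * k) t) - real (2 * k) * t\<bar> \<le> log 2 (real k + 1)"
    proof (cases "t \<le> 1 / 2")
      case True
      \<comment> \<open>No point of the right half lies below \<open>t\<close>.\<close>
      then have "count_below (2 * k) t = count_below k (2 * t)"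
        by (simp add: count_below_double count_below_nonpos)
      moreover have "real (2 * k) * t = real k * (2 * t)"
        by simp
      ultimately show ?thesis
        using less.IH[OF \<open>k < n\<close>, of "2 * t"] less.prems True by (simp only:)
    next
      case False
      \<comment> \<open>Every point of the left half lies below \<open>t\<close>.\<close>
      then have "real (count_below (2 * k) t) = real k + real (count_below k (2 * t - 1))"
        by (simp add: count_below_double count_below_ge_1)
      then have "real (count_below (2 * k) t) - real (2 * k) * t
          = real (count_below k (2 * t - 1)) - real k * (2 * t - 1)"
        by (simp add: algebra_simps)
      then show ?thesis
        using less.IH[OF \<open>k < n\<close>, of "2 * t - 1"] less.prems False by simp
    qed
    show ?thesis
    proof (cases "even n")
      case True
      then have n: "n = 2 * k"
        by (simp add: k_def)
      have "log 2 (real k + 1) \<le> log 2 (real (2 * k) + 1)"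
        by simp
      then show ?thesis
        using double unfolding n by linarith
    next
      case False
      then have n: "n = Suc (2 * k)"
        by (simp add: k_def)
      \<comment> \<open>With \<open>n + 1\<close> in the logarithm, passing from \<open>k\<close> to
        \<open>2 * k + 1\<close> raises the bound by exactly 1, which pays for the extra
        point.\<close>
      have "log 2 (real n + 1) = log 2 (2 * (real k + 1))"
        by (simp add: n algebra_simps)
      also have "\<dots> = 1 + log 2 (real k + 1)"
        by (subst log_mult) auto
      finally have "log 2 (real n + 1) = 1 + log 2 (real k + 1)" .
      moreover have "real (count_below n t) - real n * t =
          (real (count_below (2 * k) t) - real (2 * k) * t) + (of_bool (van_der_corput (2 * k) < t) - t)"
        by (simp add: n count_below_Suc algebra_simps)
      moreover have "\<bar>of_bool (van_der_corput (2 * k) < t) - t\<bar> \<le> 1"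
        using less.prems by auto
      ultimately show ?thesis
        using double by linarith
    qed
  qed
qed

lemma equidistributed_van_der_corput: "equidistributed van_der_corput"
  unfolding equidistributed_def
proof (intro conjI ballI)
  show "range van_der_corput \<subseteq> {0..<1}"
    using van_der_corput_bounds by auto
  fix t :: real
  assume t: "t \<in> {0..1}"
  have "(\<lambda>n. \<rho> n {k. van_der_corput k < t} - t) \<longlonglongrightarrow> 0"
  proof (rule tendsto_rabs_zero_cancel, rule tendsto_sandwich[of "\<lambda>_. 0"])
    have "\<bar>\<rho> n {k. van_der_corput k < t} - t\<bar> \<le> log 2 (real n + 1) / real n" if "n > 0" for n
    proof -
      have "\<rho> n {k. van_der_corput k < t} - t = (real (count_below n t) - real n * t) / real n"
        using that by (simp add: density_below_def count_below_def field_simps)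
      then show ?thesis
        using van_der_corput_discrepancy[of t n] t by (simp add: abs_divide divide_right_mono)
    qed
    then show "\<forall>\<^sub>F n in sequentially.
        \<bar>\<rho> n {k. van_der_corput k < t} - t\<bar> \<le> log 2 (real n + 1) / real n"
      using eventually_gt_at_top[of 0] by (rule eventually_mono[rotated])
    show "(\<lambda>n. log 2 (real n + 1) / real n) \<longlonglongrightarrow> 0"
      by real_asymp
  qed auto
  then show "(\<lambda>n. \<rho> n {k. van_der_corput k < t}) \<longlonglongrightarrow> t"
    by (simp add: LIM_zero_iff)
qed

section \<open>A family of equidistributed sequences with distinct geodesics\<close>

definition unfold_at :: "real \<Rightarrow> real \<Rightarrow> real"
  where "unfold_at r x = (if x < r then x / r else (x - r) / (1 - r))"

text \<open>The preimage of \<open>[0, t)\<close> consists of \<open>[0, r * t)\<close> and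
  \<open>[r, r + (1 - r) * t)\<close>, whose lengths add up to \<open>t\<close>.\<close>

lemma equidistributed_unfold_at:
  assumes u: "equidistributed u" and r: "0 < r" "r < 1"
  shows "equidistributed (\<lambda>k. unfold_at r (u k))"
  unfolding equidistributed_def
proof (intro conjI ballI)
  show "range (\<lambda>k. unfold_at r (u k)) \<subseteq> {0..<1}"
    using equidistributed_bounds[OF u] r by (auto simp: unfold_at_def)
  fix t :: real
  assume t: "t \<in> {0..1}"
  have rt: "r * t \<le> r" "0 \<le> r * t" "0 \<le> (1 - r) * t" "(1 - r) * t \<le> 1 - r"
    using r t by (simp_all add: mult_left_le)
  have iff: "unfold_at r x < t \<longleftrightarrow> x < r * t \<or> (x < r + (1 - r) * t \<and> \<not> x < r)" for x
  proof (cases "x < r")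
    case True
    then show ?thesis
      using r by (auto simp: unfold_at_def field_simps)
  next
    case False
    then have "unfold_at r x < t \<longleftrightarrow> x - r < (1 - r) * t"
      using r by (simp add: unfold_at_def pos_divide_less_eq mult.commute)
    then show ?thesis
      using False rt by auto
  qed
  have "{k. unfold_at r (u k) < t} =
      {k. u k < r * t} \<union> ({k. u k < r + (1 - r) * t} - {k. u k < r})"
    using iff by auto
  moreover have "{k. u k < r * t} \<inter> ({k. u k < r + (1 - r) * t} - {k. u k < r}) = {}"
    using rt(1) by auto
  moreover have "{k. u k < r} \<subseteq> {k. u k < r + (1 - r) * t}"
    using rt(3) by auto
  ultimately have "\<rho> n {k. unfold_at r (u k) < t} =
      \<rho> n {k. u k < r * t} + (\<rho> n {k. u k < r + (1 - r) * t} - \<rho> n {k. u k < r})" for n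
    by (simp add: density_below_Un_disjoint density_below_Diff)
  moreover have "(\<lambda>n. \<rho> n {k. u k < r * t} + (\<rho> n {k. u k < r + (1 - r) * t} - \<rho> n {k. u k < r}))
      \<longlonglongrightarrow> r * t + ((r + (1 - r) * t) - r)"
  proof -
    have "r * t \<in> {0..1}" "r + (1 - r) * t \<in> {0..1}" "r \<in> {0..1}"
      unfolding atLeastAtMost_iff using r rt by linarith+
    then show ?thesis
      using u unfolding equidistributed_def by (intro tendsto_add tendsto_diff) blast+
  qed
  moreover have "r * t + ((r + (1 - r) * t) - r) = t"
    by (simp add: algebra_simps)
  ultimately show "(\<lambda>n. \<rho> n {k. unfold_at r (u k) < t}) \<longlonglongrightarrow> t"
    by (simp only:)
qed

lemma slice_path_unfold_at_neq:
  assumes u: "equidistributed u" and AB: "upper_density (sym_diff A B) \<noteq> 0"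
    and r: "0 < r" "r < r'" "r' < 1"
  shows "slice_path A B (\<lambda>k. unfold_at r (u k)) \<noteq> slice_path A B (\<lambda>k. unfold_at r' (u k))"
proof
  let ?D = "sym_diff A B"
  let ?T = "\<lambda>r. thin ?D {k. unfold_at r (u k) < 1 / 2}"
  \<comment> \<open>On \<open>[r / 2, m)\<close> both maps use their first branch; there
    \<open>x / r\<close> is at least 1/2 while \<open>x / r'\<close> is below 1/2. The interval is
    nonempty since \<open>r < r'\<close>.\<close>
  define m where "m = min r (r' / 2)"
  have m: "r / 2 < m" "m \<le> r" "m \<le> r' / 2" "m < 1"
    using r by (auto simp: m_def)
  assume "slice_path A B (\<lambda>k. unfold_at r (u k)) = slice_path A B (\<lambda>k. unfold_at r' (u k))"
  then have "slice_path A B (\<lambda>k. unfold_at r (u k)) (1 / 2)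
      = slice_path A B (\<lambda>k. unfold_at r' (u k)) (1 / 2)"
    by simp
  then have "coarse_class (sym_diff A (?T r)) = coarse_class (sym_diff A (?T r'))"
    by (simp add: slice_path_def)
  then have zero: "upper_density (sym_diff (sym_diff A (?T r)) (sym_diff A (?T r'))) = 0"
    using dist_coarse_class by (metis dist_self)
  have "unfold_at r x \<ge> 1 / 2" "unfold_at r' x < 1 / 2" if "r / 2 \<le> x" "x < m" for x
    using that m r by (auto simp: unfold_at_def field_simps)
  then have "thin ?D {k. r / 2 \<le> u k \<and> u k < m} \<subseteq>
      sym_diff (sym_diff A (?T r)) (sym_diff A (?T r'))"
    by (fastforce simp: thin_def)
  \<comment> \<open>Monotonicity comes from subadditivity with the same set twice; doubling the
    bound is harmless as it is 0.\<close>
  then have "upper_density (thin ?D {k. r / 2 \<le> u k \<and> u k < m}) \<le> 0 + 0"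
    unfolding zero[symmetric] by (intro upper_density_subadd) simp
  moreover have "upper_density (thin ?D {k. r / 2 \<le> u k \<and> u k < m})
      = (m - r / 2) * upper_density ?D"
    using m r by (intro upper_density_thin_equidistributed u infinite_if_upper_density_nonzero AB) auto
  moreover have "0 < (m - r / 2) * upper_density ?D"
    using m AB upper_density_nonneg[of ?D] by simp
  ultimately show False
    by simp
qed

section \<open>Lower and upper bound for the number of geodesics\<close>

lemma reals_lepoll_geodesics:
  assumes "coarse_class A \<noteq> coarse_class B"
  shows "(UNIV :: real set) \<lesssim> geodesics (coarse_class A) (coarse_class B)"
proof -
  let ?\<gamma> = "\<lambda>r. slice_path A B (\<lambda>k. unfold_at r (van_der_corput k))"
  have AB: "upper_density (sym_diff A B) \<noteq> 0"
    using assms dist_coarse_class by (metis dist_eq_0_iff)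
  have "inj_on ?\<gamma> {0<..<1}"
  proof (rule inj_onI)
    fix r r' :: real
    assume "r \<in> {0<..<1}" "r' \<in> {0<..<1}" "?\<gamma> r = ?\<gamma> r'"
    then show "r = r'"
      using slice_path_unfold_at_neq[OF equidistributed_van_der_corput AB, of r r']
        slice_path_unfold_at_neq[OF equidistributed_van_der_corput AB, of r' r]
      by (cases r r' rule: linorder_cases) auto
  qed
  moreover have "?\<gamma> ` {0<..<1} \<subseteq> geodesics (coarse_class A) (coarse_class B)"
    using slice_path_geodesic equidistributed_unfold_at equidistributed_van_der_corput AB by auto
  ultimately have "{0<..<1::real} \<lesssim> geodesics (coarse_class A) (coarse_class B)"
    unfolding lepoll_def by blast
  then show ?thesis
    using open_interval_eqpoll_reals[of 0 1] eqpoll_imp_lepoll eqpoll_sym lepoll_trans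
    by (metis zero_less_one)
qed

text \<open>Geodesics are Lipschitz, so their values on a dense set of times determine them.
  Clamping lets every rational serve as an index.\<close>

lemma geodesics_eqI:
  assumes \<gamma>: "\<gamma> \<in> geodesics x y" and \<gamma>': "\<gamma>' \<in> geodesics x y"
    and eq: "\<And>q :: rat. \<gamma> (max 0 (min 1 (of_rat q))) = \<gamma>' (max 0 (min 1 (of_rat q)))"
  shows "\<gamma> = \<gamma>'"
proof (rule extensionalityI)
  show "\<gamma> \<in> extensional {0..1}" "\<gamma>' \<in> extensional {0..1}"
    using \<gamma> \<gamma>' by (auto simp: geodesics_def)
  fix t :: real
  assume t: "t \<in> {0..1}"
  have "dist (\<gamma> t) (\<gamma>' t) \<le> 0"
  proof (rule field_le_epsilon)
    fix e :: real
    assume "0 < e"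
    \<comment> \<open>Within time \<open>c\<close> each of the two geodesics moves by at most
      \<open>c * dist x y\<close>. The summand 1 keeps the denominator positive when
      \<open>x = y\<close>.\<close>
    define c where "c = e / (2 * dist x y + 1)"
    have "0 < c"
      using \<open>0 < e\<close> by (simp add: c_def add_nonneg_pos)
    obtain q where q: "t < of_rat q" "of_rat q < t + c"
      using of_rat_dense[of t "t + c"] \<open>0 < c\<close> by auto
    let ?p = "max 0 (min 1 (of_rat q)) :: real"
    \<comment> \<open>Clamping does not increase the distance to \<open>t\<close>, which already
      lies in the unit interval.\<close>
    have p: "?p \<in> {0..1}" "\<bar>?p - t\<bar> \<le> c"
      using q t by auto
    have "dist (\<gamma> t) (\<gamma>' t) \<le> dist (\<gamma> t) (\<gamma> ?p) + dist (\<gamma>' t) (\<gamma>' ?p)"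
      unfolding eq by (rule dist_triangle2)
    also have "\<dots> = \<bar>?p - t\<bar> * (2 * dist x y)"
      using \<gamma> \<gamma>' t p(1) unfolding geodesics_def by auto
    also have "\<dots> \<le> c * (2 * dist x y + 1)"
      using p(2) \<open>0 < c\<close> by (intro mult_mono) auto
    also have "\<dots> = e"
      by (simp add: c_def add_nonneg_pos less_imp_neq[symmetric])
    finally show "dist (\<gamma> t) (\<gamma>' t) \<le> 0 + e"
      by simp
  qed
  then show "\<gamma> t = \<gamma>' t"
    by simp
qed

lemma geodesics_lepoll_reals: "geodesics x y \<lesssim> (UNIV :: real set)" for x y :: coarse_class
proof -
  \<comment> \<open>The chosen representatives at all clamped rational times are packed into a
    single set of naturals by coding pairs.\<close>
  define code where "code \<gamma> = {n. case from_nat n of (q, m) \<Rightarrow>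
    m \<in> rep_coarse_class (\<gamma> (max 0 (min 1 (of_rat q))))}" for \<gamma> :: "real \<Rightarrow> coarse_class"
  have "inj_on code (geodesics x y)"
  proof (rule inj_onI)
    fix \<gamma> \<gamma>'
    assume \<gamma>: "\<gamma> \<in> geodesics x y" "\<gamma>' \<in> geodesics x y" and code: "code \<gamma> = code \<gamma>'"
    have "\<gamma> (max 0 (min 1 (of_rat q))) = \<gamma>' (max 0 (min 1 (of_rat q)))" for q
    proof -
      have "to_nat (q, m) \<in> code \<gamma> \<longleftrightarrow> to_nat (q, m) \<in> code \<gamma>'" for m :: nat
        using code by simp
      then have "rep_coarse_class (\<gamma> (max 0 (min 1 (of_rat q))))
          = rep_coarse_class (\<gamma>' (max 0 (min 1 (of_rat q))))"
        by (simp add: code_def set_eq_iff)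
      then show ?thesis
        by (metis Quotient3_coarse_class Quotient3_abs_rep)
    qed
    with \<gamma> show "\<gamma> = \<gamma>'"
      by (rule geodesics_eqI)
  qed
  then have "geodesics x y \<lesssim> (UNIV :: nat set set)"
    unfolding lepoll_def by blast
  then show ?thesis
    using nat_sets_eqpoll_reals eqpoll_imp_lepoll lepoll_trans by blast
qed

theorem theorem2p10:
  fixes A B :: "nat set"
  assumes "coarse_class A \<noteq> coarse_class B"
  shows "geodesics (coarse_class A) (coarse_class B) \<approx> (UNIV :: real set)"
  using assms by (intro lepoll_antisym geodesics_lepoll_reals reals_lepoll_geodesics)

end
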